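(* Let $p\ge2$ be an integer, let $t\ge 1$ and $m\le n$ be integers with $2t+1\le m$ (so $1\le t\le\frac{n-1}{2}$), and let $L_{f}>0$, $L_{A}\ge0$ with $L_f\ge L_A$. Let $$\mathcal X=\{\mathbf x\in\mathbb R^n:\|\mathbf x\|_2^2\le\mathcal R_{\mathcal X}^2=3(t+1)^3\},\qquad \mathcal Y=\{\mathbf y\in\mathbb R^m:\|\mathbf y\|_2^2\le\mathcal R_{\mathcal Y}^2=t+1\},$$ and consider the saddle-point problem $\min_{\mathbf x\in\mathcal X}\max_{\mathbf y\in\mathcal Y}\zeta_{2t+1}(\mathbf x,\mathbf y)$ with $\zeta_{2t+1}(\mathbf x,\mathbf y)=f_{2t+1}(\mathbf x)+\langle A_{2t+1}\mathbf x-b_{2t+1},\mathbf y\rangle$, where $f_{2t+1},A_{2t+1},b_{2t+1}$ are defined in the context. Let $(\bar{\mathbf x},\bar{\mathbf y})\in\mathcal X\times\mathcal Y$ be the output after $t$ iterations, started from $0$, of a method satisfying the oracle assumption (defined in the context) for the operator $F$ associated with this problem. Then $$\phi_{2t+1}(\bar{\mathbf x})-\psi_{2t+1}(\bar{\mathbf y})\ \ge\ \frac{1}{10\cdot3^{\frac{3(p+1)}2}}\,\frac{pL_f}{(p+1)!}\,\frac{\mathcal R_{\mathcal X}^{p+1}}{(t+1)^{\frac{3p+1}2}}+\frac{L_A}{p!}\,\frac{\mathcal R_{\mathcal X}\mathcal R_{\mathcal Y}^{p}}{\sqrt3\,(t+1)^{\frac{p+1}2}},$$ where $\phi_{2t+1}(\mathbf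 x)=f_{2t+1}(\mathbf x)+\max_{\mathbf y\in\mathcal Y}\langle A_{2t+1}\mathbf x-b_{2t+1},\mathbf y\rangle$ and $\psi_{2t+1}(\mathbf y)=\min_{\mathbf x\in\mathcal X}\{f_{2t+1}(\mathbf x)+\langle A_{2t+1}\mathbf x-b_{2t+1},\mathbf y\rangle\}$ are the primal and dual objectives.
   Context: Hard instance. For an integer $1\le s\le m$, let $B_s\in\mathbb R^{s\times s}$ be the matrix with $1$ on the anti-diagonal and $-1$ in the entries immediately to the right of the anti-diagonal entries, i.e. $(B_s\mathbf u)_1=u_s$ and $(B_s\mathbf u)_j=u_{s-j+1}-u_{s-j+2}$ for $2\le j\le s$. For $\mathbf x\in\mathbb R^n$, $B_s\mathbf x$ means $B_s$ applied to the first $s$ coordinates of $\mathbf x$. Define $$f_s(\mathbf x)=\frac{L_f}{(p+1)!}\Big(\sum_{i=1}^{s}|(B_s\mathbf x)_i|^{p+1}+\sum_{i=s+1}^{n}|x_i|^{p+1}\Big)-\frac1{p!}\Big(L_f+\frac{L_A}2\Big)x_1,$$ $$A_s=\frac{L_A}{p!}\begin{bmatrix}B_s&0&0\\0&G&0\end{bmatrix}\in\mathbb R^{m\times n},\qquad b_s=\frac{L_A}{p!}\begin{bmatrix}\mathbf 1_s\\0\end{bmatrix}\in\mathbb R^m,$$ where $G\in\mathbb R^{(m-s)\times(m-s)}$ is a full-rank matrix with spectral norm $2$ (absent if $m=s$), the last $n-m$ columns of $A_s$ are zero, and $\mathbf 1_s$ is the all-ones vector in $\mathbb R^s$. Operator.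 With $\mathbf z=(\mathbf x,\mathbf y)\in\mathbb R^n\times\mathbb R^m$, the monotone operator associated with $\min_{\mathbf x}\max_{\mathbf y}\zeta_s(\mathbf x,\mathbf y)$ is $F(\mathbf z)=\big(\nabla f_s(\mathbf x)+A_s^\top\mathbf y,\ -(A_s\mathbf x-b_s)\big)$. Oracle assumption. For $\mathbf z$, $\mathbf a=(a_0,\dots,a_{p-1})\in\mathbb R^p$, $\gamma>0$ and a real exponent $q>1$, let $$\Phi_{\mathbf a,\gamma,q}(\mathbf h)=\sum_{i=0}^{p-1}a_i\nabla^iF(\mathbf z)[\mathbf h]^{i+1}+\gamma\|\mathbf h\|_2^q,$$ where $\nabla^iF(\mathbf z)[\mathbf h]^{i+1}=\langle\nabla^iF(\mathbf z)[\mathbf h]^i,\mathbf h\rangle$ and $\nabla^iF(\mathbf z)[\mathbf h]^i$ is the $i$th directional derivative of $F$ at $\mathbf z$ along $\mathbf h$. Let $\Gamma_{\mathbf z,F}(\mathbf a,\gamma,q)$ be the set of stationary points of $\Phi_{\mathbf a,\gamma,q}$ and let $S_F(\mathbf z)$ be the linear span of the union of the sets $\Gamma_{\mathbf z,F}(\mathbf a,\gamma,q)$ over all $\mathbf a\in\mathbb R^p,\gamma>0,q>1$. A method satisfies the oracle assumption if it generates points $\mathbf z^{(0)},\mathbf z^{(1)},\dots\in\mathcal X\times\mathcal Y$ with $\mathbf z^{(k+1)}\in\mathbf z^{(0)}+\sum_{i=0}^{k}S_F(\mathbf z^{(i)})$ for all $k\ge0$. Its output after $t$ iterations is $(\bar{\mathbf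 x},\bar{\mathbf y})=\mathbf z^{(t)}$; here $\mathbf z^{(0)}=0$. *)

theory Defs
  imports "HOL-Analysis.Analysis" "Jordan_Normal_Form.DL_Rank"
begin

no_notation Matrix.vec_index (infixl \<open>$\<close> 100)
no_notation Matrix.scalar_prod (infix \<open>\<bullet>\<close> 70)

text \<open>
  The spaces of dimension n and m are \<open>real ^ 'n\<close> and \<open>real ^ 'm\<close>, with \<open>n = CARD('n)\<close> and
  \<open>m = CARD('m)\<close>, over linearly ordered finite index types: the order says which coordinate is the
  first, the second, and so on. The blocks whose size depends on \<open>s\<close> are matrices and vectors of
  \<open>Jordan_Normal_Form\<close>. All indices start at 0.
\<close>

definition pos :: "'i::{finite,linorder} \<Rightarrow> nat" where
  "pos k = card {j. j < k}"

definition idx :: "nat \<Rightarrow> 'i::{finite,linorder}" where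
  "idx i = inv_into UNIV pos i"

lemma pos_strict_mono: "strict_mono (pos :: 'i::{finite,linorder} \<Rightarrow> nat)"
proof (rule strict_monoI)
  fix a b :: 'i assume "a < b"
  then have "{j. j < a} \<subset> {j. j < b}" by force
  then show "pos a < pos b" unfolding pos_def by (intro psubset_card_mono) auto
qed

lemma bij_betw_pos: "bij_betw pos (UNIV :: 'i::{finite,linorder} set) {..<CARD('i)}"
proof -
  have inj: "inj (pos :: 'i \<Rightarrow> nat)"
    using pos_strict_mono strict_mono_imp_inj_on by blast
  have "pos k < CARD('i)" for k :: 'i
    unfolding pos_def by (intro psubset_card_mono) auto
  then have sub: "range (pos :: 'i \<Rightarrow> nat) \<subseteq> {..<CARD('i)}" by auto
  then have "range (pos :: 'i \<Rightarrow> nat) = {..<CARD('i)}"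
    by (intro card_subset_eq) (auto simp: card_image[OF inj])
  then show ?thesis using inj by (simp add: bij_betw_def)
qed

lemma idx_pos: "idx (pos k) = (k :: 'i::{finite,linorder})"
  unfolding idx_def using pos_strict_mono strict_mono_imp_inj_on by (blast intro: inv_f_f)

lemma pos_idx: "i < CARD('i) \<Longrightarrow> pos (idx i :: 'i::{finite,linorder}) = i"
  unfolding idx_def using bij_betw_pos[where 'i='i] by (intro f_inv_into_f) (auto simp: bij_betw_def)


subsection \<open>The hard instance\<close>

definition B_mat :: "nat \<Rightarrow> real mat" where
  "B_mat s = mat s s (\<lambda>(i, j). if i + j + 1 = s then 1 else if i + j = s then - 1 else 0)"

lemma B_mat_mult_vec:
  assumes "u \<in> carrier_vec s" and "i < s"
  shows "vec_index (B_mat s *\<^sub>v u) i =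
    (if i = 0 then vec_index u (s - 1) else vec_index u (s - i - 1) - vec_index u (s - i))"
proof -
  have "vec_index (B_mat s *\<^sub>v u) i =
      (\<Sum>j\<in>{0..<s}. (if j = s - i - 1 then vec_index u j else 0)
        - (if j = s - i then vec_index u j else 0))"
    using assms by (auto simp: B_mat_def scalar_prod_def intro!: sum.cong)
  then show ?thesis using assms by (auto simp: sum_subtractf)
qed

definition B_app :: "nat \<Rightarrow> real ^ 'n::{finite,linorder} \<Rightarrow> real Matrix.vec" where
  "B_app s x = B_mat s *\<^sub>v Matrix.vec s (\<lambda>i. x $ idx i)"

definition f_inst :: "nat \<Rightarrow> real \<Rightarrow> real \<Rightarrow> nat \<Rightarrow> real ^ 'n::{finite,linorder} \<Rightarrow> real" where
  "f_inst p Lf LA s x =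
     Lf / fact (p + 1) *
       ((\<Sum>i<s. \<bar>vec_index (B_app s x) i\<bar> ^ (p + 1)) + (\<Sum>i = s..<CARD('n). \<bar>x $ idx i\<bar> ^ (p + 1)))
     - 1 / fact p * (Lf + LA / 2) * x $ idx 0"

definition A_inst :: "nat \<Rightarrow> real \<Rightarrow> nat \<Rightarrow> real mat
    \<Rightarrow> real ^ 'n::{finite,linorder} ^ 'm::{finite,linorder}" where
  "A_inst p LA s G = (\<chi> r c. LA / fact p *
     (if pos c < CARD('m)
      then four_block_mat (B_mat s) (0\<^sub>m s (CARD('m) - s)) (0\<^sub>m (CARD('m) - s) s) G $$ (pos r, pos c)
      else 0))"

definition b_inst :: "nat \<Rightarrow> real \<Rightarrow> nat \<Rightarrow> real ^ 'm::{finite,linorder}" where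
  "b_inst p LA s = (\<chi> r. LA / fact p * (if pos r < s then 1 else 0))"

definition spectral_norm :: "real mat \<Rightarrow> real" where
  "spectral_norm M =
     (SUP v\<in>{v \<in> carrier_vec (dim_col M). sqrt (scalar_prod v v) \<le> 1}.
        sqrt (scalar_prod (M *\<^sub>v v) (M *\<^sub>v v)))"

text \<open>If the block has size 0 it is absent, and only its (empty) format is required.\<close>

definition admissible_block :: "nat \<Rightarrow> real mat \<Rightarrow> bool" where
  "admissible_block k G \<longleftrightarrow> G \<in> carrier_mat k k \<and>
     (0 < k \<longrightarrow> vec_space.rank k G = k \<and> spectral_norm G = 2)"


subsection \<open>The saddle-point problem and its operator\<close>

definition R_X :: "nat \<Rightarrow> real" where
  "R_X t = sqrt (3 * (real t + 1) ^ 3)"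

definition R_Y :: "nat \<Rightarrow> real" where
  "R_Y t = sqrt (real t + 1)"

definition X_set :: "nat \<Rightarrow> (real ^ 'n) set" where
  "X_set t = {x. (norm x)\<^sup>2 \<le> (R_X t)\<^sup>2}"

definition Y_set :: "nat \<Rightarrow> (real ^ 'm) set" where
  "Y_set t = {y. (norm y)\<^sup>2 \<le> (R_Y t)\<^sup>2}"

definition zeta :: "(real ^ 'n \<Rightarrow> real) \<Rightarrow> real ^ 'n ^ 'm \<Rightarrow> real ^ 'm \<Rightarrow> real ^ 'n \<Rightarrow> real ^ 'm \<Rightarrow> real" where
  "zeta f A b x y = f x + inner (A *v x - b) y"

text \<open>
  For continuous \<open>f\<close> and nonempty compact \<open>X\<close> and \<open>Y\<close>, such as the balls above, the supremum and the
  infimum are attained, so they are the maximum and the minimum.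
\<close>

definition phi :: "(real ^ 'n \<Rightarrow> real) \<Rightarrow> real ^ 'n ^ 'm \<Rightarrow> real ^ 'm \<Rightarrow> (real ^ 'm) set \<Rightarrow> real ^ 'n \<Rightarrow> real" where
  "phi f A b Y x = f x + (SUP y\<in>Y. inner (A *v x - b) y)"

definition psi :: "(real ^ 'n \<Rightarrow> real) \<Rightarrow> real ^ 'n ^ 'm \<Rightarrow> real ^ 'm \<Rightarrow> (real ^ 'n) set \<Rightarrow> real ^ 'm \<Rightarrow> real" where
  "psi f A b X y = (INF x\<in>X. zeta f A b x y)"

definition gradient :: "('a::real_inner \<Rightarrow> real) \<Rightarrow> 'a \<Rightarrow> 'a" where
  "gradient g x = (THE D. GDERIV g x :> D)"

definition F_op :: "(real ^ 'n \<Rightarrow> real) \<Rightarrow> real ^ 'n ^ 'm \<Rightarrow> real ^ 'm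
    \<Rightarrow> (real ^ 'n) \<times> (real ^ 'm) \<Rightarrow> (real ^ 'n) \<times> (real ^ 'm)" where
  "F_op f A b = (\<lambda>(x, y). (gradient f x + transpose A *v y, - (A *v x - b)))"


subsection \<open>The oracle assumption\<close>

definition dir_deriv :: "nat \<Rightarrow> ('a::real_normed_vector \<Rightarrow> 'b::real_normed_vector) \<Rightarrow> 'a \<Rightarrow> 'a \<Rightarrow> 'b" where
  "dir_deriv i F z h =
     ((\<lambda>g \<tau>. vector_derivative g (at \<tau>)) ^^ i) (\<lambda>\<tau>::real. F (z + \<tau> *\<^sub>R h)) 0"

text \<open>
  \<open>dir_deriv i F z h\<close> is the \<open>i\<close>-th derivative of \<open>\<tau> \<mapsto> F (z + \<tau> h)\<close> at 0. Of the sequence \<open>a\<close> below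
  only the entries \<open>a 0, \<dots>, a (p - 1)\<close> are used, so it stands for a vector with \<open>p\<close> entries.
\<close>

definition Phi :: "nat \<Rightarrow> ('a::real_inner \<Rightarrow> 'a) \<Rightarrow> 'a \<Rightarrow> (nat \<Rightarrow> real) \<Rightarrow> real \<Rightarrow> real \<Rightarrow> 'a \<Rightarrow> real" where
  "Phi p F z a \<gamma> q h = (\<Sum>i<p. a i * inner (dir_deriv i F z h) h) + \<gamma> * norm h powr q"

definition Gamma_set :: "nat \<Rightarrow> ('a::real_inner \<Rightarrow> 'a) \<Rightarrow> 'a \<Rightarrow> (nat \<Rightarrow> real) \<Rightarrow> real \<Rightarrow> real \<Rightarrow> 'a set" where
  "Gamma_set p F z a \<gamma> q = {h. GDERIV (Phi p F z a \<gamma> q) h :> 0}"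

definition S_space :: "nat \<Rightarrow> ('a::real_inner \<Rightarrow> 'a) \<Rightarrow> 'a \<Rightarrow> 'a set" where
  "S_space p F z = Real_Vector_Spaces.span (\<Union>{Gamma_set p F z a \<gamma> q |a \<gamma> q. 0 < \<gamma> \<and> 1 < q})"

definition oracle_assumption :: "nat \<Rightarrow> ('a::real_inner \<Rightarrow> 'a) \<Rightarrow> 'a set \<Rightarrow> (nat \<Rightarrow> 'a) \<Rightarrow> bool" where
  "oracle_assumption p F Z z \<longleftrightarrow>
     (\<forall>k. z k \<in> Z) \<and>
     (\<forall>k. z (Suc k) \<in> {z 0 + (\<Sum>i\<le>k. w i) |w. \<forall>i\<le>k. w i \<in> S_space p F (z i)})"

end

theory Submission
  imports Defs
begin

text \<open>
  Moving \<open>h\<close> in a direction \<open>v\<close> changes only the norm term of \<open>\<Phi>\<close> as soon as \<open>v\<close> is orthogonal to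
  \<open>F z\<close> and to every \<open>l r\<close> with \<open>inner (l r) z \<noteq> 0\<close>, where \<open>\<bar>inner (l r) z\<bar> ^ (p + 1)\<close> are the power
  terms of \<open>f\<close>: these have vanishing derivatives up to order \<open>p\<close> where \<open>inner (l r) z = 0\<close>, and the
  bilinear coupling is skew, so it drops out of \<open>\<nabla>F[h]\<^sup>2\<close>. Hence stationary points are orthogonal
  to all such \<open>v\<close>. As \<open>B\<^sub>s\<^sup>2\<close> is tridiagonal and \<open>B\<^sub>s 1 = e\<^sub>1\<close>, each iteration reveals one more
  coordinate of \<open>x\<close>, so the output satisfies \<open>x\<^sub>j = 0\<close> for \<open>j > t\<close>.

  The dual value is at most \<open>f (s, s - 1, \<dots>, 1)\<close> because \<open>A (s, \<dots>, 1) = b\<close>, whatever the dual output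
  is. For the primal value, the first \<open>t + 1\<close> entries of \<open>A x - b\<close> are \<open>- LA / p!\<close>, which produces the
  second summand of the bound, and \<open>f x\<close> decouples into \<open>t\<close> one-dimensional problems in the
  differences \<open>x\<^sub>j - x\<^sub>j\<^sub>+\<^sub>1\<close>. The first summand comes from comparing \<open>t\<close> of these with the \<open>s = 2 t + 1\<close>
  of the dual side.
\<close>

subsection \<open>Stationary points for sums of powers with a skew coupling\<close>

text \<open>Each differentiation adds one factor \<open>sgn\<close>; the exponent \<open>e\<close>
  keeps the family closed under it. At 0 the difference quotient is at most
  \<open>\<bar>h\<bar> ^ (n - 1)\<close>, which tends to 0 as \<open>n\<close> is at least
  2.\<close>

lemma DERIV_abs_power_sgn:
  fixes u :: real
  assumes n: "2 \<le> n"
  shows "DERIV (\<lambda>x. \<bar>x\<bar> ^ n * sgn x ^ e) u :> real n * \<bar>u\<bar> ^ (n - 1) * sgn u ^ (e + 1)"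
proof -
  consider "u > 0" | "u < 0" | "u = 0" by linarith
  then show ?thesis
  proof cases
    case 1
    have "DERIV (\<lambda>x. x ^ n) u :> real n * \<bar>u\<bar> ^ (n - 1) * sgn u ^ (e + 1)"
      using 1 by (auto intro!: derivative_eq_intros)
    then show ?thesis
      by (rule has_field_derivative_transform_within_open[of _ _ _ "{0<..}"]) (use 1 in auto)
  next
    case 2
    have "DERIV (\<lambda>x. (- x) ^ n * (- 1) ^ e) u :> real n * \<bar>u\<bar> ^ (n - 1) * sgn u ^ (e + 1)"
      using 2 by (auto intro!: derivative_eq_intros)
    then show ?thesis
      by (rule has_field_derivative_transform_within_open[of _ _ _ "{..<0}"]) (use 2 in auto)
  next
    case 3
    have "((\<lambda>h::real. \<bar>h\<bar> ^ (n - 1)) \<longlongrightarrow> 0) (at 0)"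
      by (rule tendsto_eq_intros tendsto_ident_at refl | use n in simp)+
    then have "((\<lambda>h. (\<bar>h\<bar> ^ n * sgn h ^ e) / h) \<longlongrightarrow> 0) (at (0::real))"
    proof (rule Lim_null_comparison[rotated])
      show "\<forall>\<^sub>F h in at (0::real). norm ((\<bar>h\<bar> ^ n * sgn h ^ e) / h) \<le> \<bar>h\<bar> ^ (n - 1)"
        unfolding eventually_at
      proof (intro exI[of _ 1] conjI ballI impI)
        fix h :: real assume "h \<noteq> 0 \<and> dist h 0 < 1"
        moreover have "n = Suc (n - 1)" using n by simp
        then have "\<bar>h\<bar> ^ n = \<bar>h\<bar> * \<bar>h\<bar> ^ (n - 1)" by (metis power_Suc)
        ultimately show "norm ((\<bar>h\<bar> ^ n * sgn h ^ e) / h) \<le> \<bar>h\<bar> ^ (n - 1)"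
          by (simp add: abs_mult power_abs abs_sgn_eq)
      qed simp
    qed
    then show ?thesis using 3 n by (simp add: DERIV_def zero_power)
  qed
qed

text \<open>
  \<open>abs_power_deriv p i\<close> is the \<open>i\<close>-th derivative of \<open>u \<mapsto> \<bar>u\<bar> ^ p * sgn u\<close>, which exists at 0 only
  for \<open>i < p\<close>.
\<close>

definition abs_power_deriv :: "nat \<Rightarrow> nat \<Rightarrow> real \<Rightarrow> real" where
  "abs_power_deriv p i u = fact p / fact (p - i) * (\<bar>u\<bar> ^ (p - i) * sgn u ^ (i + 1))"

text \<open>\<open>i + 1 < p\<close> makes the exponent \<open>p - i\<close> at least 2, so
  \<open>DERIV_abs_power_sgn\<close> also covers the point 0.\<close>

lemma DERIV_abs_power_deriv:
  assumes "i + 1 < p"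
  shows "DERIV (abs_power_deriv p i) u :> abs_power_deriv p (i + 1) u"
proof -
  have "(fact (p - i) :: real) = real (p - i) * fact (p - (i + 1))"
    using assms fact_reduce[of "p - i", where 'a=real] by simp
  moreover have "real (p - i) \<noteq> 0" using assms by simp
  ultimately have "fact p / (fact (p - i) :: real) * real (p - i) = fact p / fact (p - (i + 1))"
    by (simp del: of_nat_diff of_nat_eq_0_iff)
  then have eq: "fact p / fact (p - i) * (real (p - i) * \<bar>u\<bar> ^ (p - i - 1) * sgn u ^ (i + 1 + 1))
      = abs_power_deriv p (i + 1) u"
    unfolding abs_power_deriv_def
    by (metis (no_types, lifting) diff_diff_left mult.assoc)
  show ?thesis
    unfolding eq[symmetric] unfolding abs_power_deriv_def[of p i, abs_def]
    by (rule DERIV_cmult, rule DERIV_abs_power_sgn) (use assms in auto)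
qed

lemma abs_power_deriv_0 [simp]: "i < p \<Longrightarrow> abs_power_deriv p i 0 = 0"
  by (simp add: abs_power_deriv_def)

text \<open>The operator of the problem has this shape on pairs \<open>(x, y)\<close>: the power
  terms act on \<open>x\<close> only, \<open>e\<close> collects the linear term of \<open>f\<close>
  and \<open>b\<close>, and \<open>L\<close> is the bilinear coupling.\<close>

locale power_field =
  fixes R :: "nat set" and l :: "nat \<Rightarrow> 'a::real_inner" and C :: real and p :: nat
    and e :: 'a and L :: "'a \<Rightarrow> 'a" and F :: "'a \<Rightarrow> 'a"
  assumes linear_L: "linear L"
    and skew: "inner (L h) h = 0"
    and F_eq: "F z = (\<Sum>r\<in>R. (C * abs_power_deriv p 0 (inner (l r) z)) *\<^sub>R l r) + e + L z"
begin

definition ray_deriv :: "'a \<Rightarrow> 'a \<Rightarrow> nat \<Rightarrow> real \<Rightarrow> 'a" where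
  "ray_deriv z h i \<tau> =
     (\<Sum>r\<in>R. (C * abs_power_deriv p i (inner (l r) z + \<tau> * inner (l r) h) * inner (l r) h ^ i) *\<^sub>R l r)
     + (if i = 0 then e + L z + \<tau> *\<^sub>R L h else if i = 1 then L h else 0)"

lemma ray_deriv_Suc:
  assumes "i + 1 < p"
  shows "(ray_deriv z h i has_vector_derivative ray_deriv z h (i + 1) \<tau>) (at \<tau>)"
proof -
  have 1: "((\<lambda>\<tau>. abs_power_deriv p i (inner (l r) z + \<tau> * inner (l r) h))
      has_field_derivative abs_power_deriv p (i + 1) (inner (l r) z + \<tau> * inner (l r) h) * inner (l r) h)
      (at \<tau>)" for r
    by (rule DERIV_chain2[OF DERIV_abs_power_deriv[OF assms]]) (auto intro!: derivative_eq_intros)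
  have 2: "((\<lambda>\<tau>. (C * abs_power_deriv p i (inner (l r) z + \<tau> * inner (l r) h) * inner (l r) h ^ i) *\<^sub>R l r)
      has_vector_derivative (C * abs_power_deriv p (i + 1) (inner (l r) z + \<tau> * inner (l r) h)
        * inner (l r) h ^ (i + 1)) *\<^sub>R l r) (at \<tau>)" for r
    by (rule has_vector_derivative_eq_rhs,
        rule has_vector_derivative_scaleR[OF DERIV_cmult_right[OF DERIV_cmult[OF 1]] has_vector_derivative_const])
      (simp add: mult_ac)
  have 3: "((\<lambda>\<tau>. if i = 0 then e + L z + \<tau> *\<^sub>R L h else if i = 1 then L h else 0)
      has_vector_derivative (if i + 1 = 0 then e + L z + \<tau> *\<^sub>R L h else if i + 1 = 1 then L h else 0)) (at \<tau>)"
    by (auto intro!: derivative_eq_intros)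
  show ?thesis
    unfolding ray_deriv_def by (intro has_vector_derivative_add has_vector_derivative_sum 2 3)
qed

lemma dir_deriv_F:
  assumes "i < p"
  shows "dir_deriv i F z h = ray_deriv z h i 0"
proof -
  \<comment> \<open>Equality is needed for all \<open>\<tau>\<close>, since the induction
    differentiates once more at each step.\<close>
  have "((\<lambda>g \<tau>. vector_derivative g (at \<tau>)) ^^ i) (\<lambda>\<tau>::real. F (z + \<tau> *\<^sub>R h)) = ray_deriv z h i"
    using assms
  proof (induction i)
    case 0
    show ?case
      by (auto simp: fun_eq_iff ray_deriv_def F_eq inner_add_right linear_add[OF linear_L]
          linear_scale[OF linear_L])
  next
    case (Suc i)
    then have "vector_derivative (ray_deriv z h i) (at \<tau>) = ray_deriv z h (Suc i) \<tau>" for \<tau>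
      using vector_derivative_at[OF ray_deriv_Suc[of i z h \<tau>]] by simp
    then show ?case using Suc by simp
  qed
  then show ?thesis by (simp add: dir_deriv_def)
qed

text \<open>In order 1 the coupling contributes \<open>inner (L h) h\<close>, which is 0 by
  \<open>skew\<close>; in order 0 it contributes \<open>L z\<close>, which stays.\<close>

lemma inner_dir_deriv:
  assumes "i < p"
  shows "inner (dir_deriv i F z h) h =
    (\<Sum>r\<in>R. C * abs_power_deriv p i (inner (l r) z) * inner (l r) h ^ (i + 1))
    + (if i = 0 then inner (e + L z) h else 0)"
  unfolding dir_deriv_F[OF assms] ray_deriv_def
  by (auto simp: inner_add_left inner_sum_left skew mult_ac)

text \<open>Along the line \<open>w\<close> through \<open>h\<close> in direction \<open>v\<close>
  only the norm term varies, and for nonzero \<open>h\<close> its derivative at 0 is a positive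
  multiple of \<open>inner h v\<close>.\<close>

lemma Gamma_set_orthogonal:
  assumes "0 < \<gamma>" "1 < q" and h: "h \<in> Gamma_set p F z a \<gamma> q"
    and v: "inner (F z) v = 0" "\<And>r. r \<in> R \<Longrightarrow> inner (l r) z = 0 \<or> inner (l r) v = 0"
  shows "inner h v = 0"
proof (cases "h = 0")
  case False
  define w where "w \<tau> = h + \<tau> *\<^sub>R v" for \<tau>
  \<comment> \<open>For \<open>i = 0\<close>, \<open>F z\<close> is orthogonal to \<open>v\<close>.
    For larger \<open>i < p\<close>, a row either has \<open>inner (l r) z = 0\<close>, where
    \<open>abs_power_deriv p i\<close> vanishes, or is orthogonal to \<open>v\<close>.\<close>
  have inv: "inner (dir_deriv i F z (w \<tau>)) (w \<tau>) = inner (dir_deriv i F z h) h" if i: "i < p" for i \<tau>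
  proof (cases "i = 0")
    case True
    then show ?thesis using v(1) by (simp add: dir_deriv_def w_def inner_add_right)
  next
    case False
    have "abs_power_deriv p i (inner (l r) z) * inner (l r) (w \<tau>) ^ (i + 1)
        = abs_power_deriv p i (inner (l r) z) * inner (l r) h ^ (i + 1)" if "r \<in> R" for r
      using v(2)[OF that] i by (auto simp: w_def inner_add_right)
    then show ?thesis using False
      unfolding inner_dir_deriv[OF i] by (auto intro!: sum.cong simp: mult.assoc)
  qed
  define K where "K = (\<Sum>i<p. a i * inner (dir_deriv i F z h) h)"
  have Phi_w: "Phi p F z a \<gamma> q (w \<tau>) = K + \<gamma> * norm (w \<tau>) powr q" for \<tau>
    unfolding Phi_def K_def by (auto intro!: sum.cong simp: inv)
  have dw: "(w has_derivative (\<lambda>\<tau>. \<tau> *\<^sub>R v)) (at 0)"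
    unfolding w_def by (auto intro!: derivative_eq_intros)
  have w0: "w 0 = h" by (simp add: w_def)
  \<comment> \<open>The derivative along the line is computed twice: here it is 0 by stationarity,
    below it comes from the chain rule for the norm.\<close>
  have "((\<lambda>\<tau>. Phi p F z a \<gamma> q (w \<tau>)) has_derivative (\<lambda>\<tau>. inner (\<tau> *\<^sub>R v) 0)) (at 0)"
    by (rule has_derivative_compose[OF dw]) (use h w0 in \<open>simp add: Gamma_set_def gderiv_def\<close>)
  then have "DERIV (\<lambda>\<tau>. K + \<gamma> * norm (w \<tau>) powr q) 0 :> 0"
    unfolding Phi_w by (simp add: has_field_derivative_def lambda_zero)
  moreover have "((\<lambda>\<tau>. norm (w \<tau>)) has_derivative (\<lambda>\<tau>. inner (\<tau> *\<^sub>R v) (sgn h))) (at 0)"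
    by (rule has_derivative_compose[OF dw]) (use has_derivative_norm[OF False] w0 in simp)
  then have "DERIV (\<lambda>\<tau>. norm (w \<tau>)) 0 :> inner v (sgn h)"
    by (rule has_derivative_imp_has_field_derivative) simp
  then have "DERIV (\<lambda>\<tau>. norm (w \<tau>) powr q) 0 :> q * norm (w 0) powr (q - 1) * inner v (sgn h)"
    by (rule DERIV_chain2[rotated]) (use False w0 in \<open>auto intro!: has_real_derivative_powr\<close>)
  then have "DERIV (\<lambda>\<tau>. K + \<gamma> * norm (w \<tau>) powr q) 0
      :> 0 + \<gamma> * (q * norm (w 0) powr (q - 1) * inner v (sgn h))"
    by (intro DERIV_add DERIV_const DERIV_cmult)
  ultimately have "\<gamma> * (q * norm h powr (q - 1) * inner v (sgn h)) = 0"
    using DERIV_unique w0 by fastforce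
  then show ?thesis using assms False by (simp add: sgn_div_norm inner_commute)
qed simp

lemma S_space_orthogonal:
  assumes "w \<in> S_space p F z"
    and "inner (F z) v = 0" "\<And>r. r \<in> R \<Longrightarrow> inner (l r) z = 0 \<or> inner (l r) v = 0"
  shows "inner w v = 0"
proof -
  have "w \<in> {h. inner v h = 0}"
    using assms(1) unfolding S_space_def
  proof (rule subsetD[OF Real_Vector_Spaces.span_minimal, rotated 2])
    show "Real_Vector_Spaces.subspace {h. inner v h = 0}" by (rule subspace_hyperplane)
  next
    show "\<Union> {Gamma_set p F z a \<gamma> q |a \<gamma> q. 0 < \<gamma> \<and> 1 < q} \<subseteq> {h. inner v h = 0}"
      using Gamma_set_orthogonal[of _ _ _ z _ v] assms(2,3) by (fastforce simp: inner_commute)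
  qed
  then show ?thesis by (simp add: inner_commute)
qed

end

subsection \<open>Rows of the hard instance\<close>

lemma B_app_index:
  "i < s \<Longrightarrow> vec_index (B_app s x) i =
    (if i = 0 then x $ idx (s - 1) else x $ idx (s - i - 1) - x $ idx (s - i))"
  by (simp add: B_app_def B_mat_mult_vec)

lemma B_app_index_sum:
  "i < s \<Longrightarrow> vec_index (B_app s x) i = (\<Sum>j<s. B_mat s $$ (i, j) * x $ idx j)"
  by (auto simp: B_app_def B_mat_def scalar_prod_def lessThan_atLeast0 intro!: sum.cong)

lemma B_mat_symmetric: "i < s \<Longrightarrow> j < s \<Longrightarrow> B_mat s $$ (i, j) = B_mat s $$ (j, i)"
  by (auto simp: B_mat_def add.commute)

lemma sum_pos: "(\<Sum>c\<in>(UNIV :: 'i::{finite,linorder} set). g (pos c)) = (\<Sum>j<CARD('i). g j)"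
  by (rule sum.reindex_bij_betw[OF bij_betw_pos])

lemma pos_less_card: "pos (c :: 'i::{finite,linorder}) < CARD('i)"
  using bij_betw_pos[where 'i='i] by (auto simp: bij_betw_def)

text \<open>Entries with both positions at least \<open>s\<close> are left out: the block
  \<open>G\<close> sits there.\<close>

lemma A_inst_entry:
  fixes r :: "'m::{finite,linorder}" and c :: "'n::{finite,linorder}"
  assumes "s \<le> CARD('m)" and "G \<in> carrier_mat (CARD('m) - s) (CARD('m) - s)"
    and "pos r < s \<or> pos c < s"
  shows "(A_inst p LA s G :: real ^ 'n::{finite,linorder} ^ 'm::{finite,linorder}) $ r $ c =
    LA / fact p * (if pos r < s \<and> pos c < s then B_mat s $$ (pos r, pos c) else 0)"
  using assms pos_less_card[of r] by (auto simp: A_inst_def B_mat_def)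

lemma A_inst_mult:
  fixes x :: "real ^ 'n::{finite,linorder}"
  assumes s: "s \<le> CARD('m::{finite,linorder})" "CARD('m) \<le> CARD('n)"
    and G: "G \<in> carrier_mat (CARD('m) - s) (CARD('m) - s)"
    and x: "\<And>j. s \<le> j \<Longrightarrow> j < CARD('n) \<Longrightarrow> x $ idx j = 0"
  shows "((A_inst p LA s G :: real ^ 'n::{finite,linorder} ^ 'm::{finite,linorder}) *v x) $ r =
    LA / fact p * (if pos r < s then vec_index (B_app s x) (pos r) else 0)"
proof -
  \<comment> \<open>The summand as a function of positions; it is 0 from \<open>s\<close> on, where
    \<open>x\<close> vanishes and the columns of \<open>G\<close> begin.\<close>
  define g where "g j = (if j < s then LA / fact p *
      (if pos r < s then B_mat s $$ (pos r, j) else 0) * x $ idx j else 0)" for j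
  have "((A_inst p LA s G :: real ^ 'n::{finite,linorder} ^ 'm::{finite,linorder}) *v x) $ r
      = (\<Sum>c\<in>UNIV. (A_inst p LA s G :: real ^ 'n::{finite,linorder} ^ 'm::{finite,linorder}) $ r $ c * x $ c)"
    by (simp add: matrix_vector_mult_def)
  also have "\<dots> = (\<Sum>c\<in>UNIV. g (pos (c :: 'n)))"
  proof (intro sum.cong refl)
    fix c :: 'n
    show "(A_inst p LA s G :: real ^ 'n::{finite,linorder} ^ 'm::{finite,linorder}) $ r $ c * x $ c = g (pos c)"
    proof (cases "pos c < s")
      case True
      then show ?thesis by (simp add: A_inst_entry[OF s(1) G] g_def idx_pos)
    next
      case False
      then show ?thesis using x[of "pos c"] pos_less_card[of c] by (simp add: g_def idx_pos)
    qed
  qed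
  also have "\<dots> = (\<Sum>j<CARD('n). g j)" by (rule sum_pos)
  also have "\<dots> = (\<Sum>j<s. g j)"
    using s by (intro sum.mono_neutral_right) (auto simp: g_def)
  also have "\<dots> = LA / fact p * (if pos r < s then vec_index (B_app s x) (pos r) else 0)"
    by (simp add: g_def B_app_index_sum sum_distrib_left sum_divide_distrib mult.assoc)
  finally show ?thesis .
qed

text \<open>\<open>B_mat s\<close> is symmetric, so the transpose acts by the same block; the zeros
  of \<open>y\<close> from \<open>s\<close> on remove the rows of \<open>G\<close>.\<close>

lemma A_inst_transpose_mult:
  fixes y :: "real ^ 'm::{finite,linorder}" and c :: "'n::{finite,linorder}"
  assumes s: "s \<le> CARD('m)"
    and G: "G \<in> carrier_mat (CARD('m) - s) (CARD('m) - s)"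
    and y: "\<And>i. s \<le> i \<Longrightarrow> i < CARD('m) \<Longrightarrow> y $ idx i = 0"
  shows "(transpose (A_inst p LA s G :: real ^ 'n::{finite,linorder} ^ 'm::{finite,linorder}) *v y) $ c =
    LA / fact p * (if pos c < s then vec_index (B_app s y) (pos c) else 0)"
proof -
  define g where "g i = (if i < s then LA / fact p *
      (if pos c < s then B_mat s $$ (pos c, i) else 0) * y $ idx i else 0)" for i
  have "(transpose (A_inst p LA s G :: real ^ 'n::{finite,linorder} ^ 'm::{finite,linorder}) *v y) $ c
      = (\<Sum>r\<in>UNIV. (A_inst p LA s G :: real ^ 'n::{finite,linorder} ^ 'm::{finite,linorder}) $ r $ c * y $ r)"
    by (simp add: matrix_vector_mult_def transpose_def)
  also have "\<dots> = (\<Sum>r\<in>UNIV. g (pos (r :: 'm)))"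
  proof (intro sum.cong refl)
    fix r :: 'm
    show "(A_inst p LA s G :: real ^ 'n::{finite,linorder} ^ 'm::{finite,linorder}) $ r $ c * y $ r = g (pos r)"
    proof (cases "pos r < s")
      case True
      then show ?thesis
        by (auto simp: A_inst_entry[OF s G] g_def idx_pos B_mat_symmetric[of "pos c"])
    next
      case False
      then show ?thesis using y[of "pos r"] pos_less_card[of r] by (simp add: g_def idx_pos)
    qed
  qed
  also have "\<dots> = (\<Sum>i<CARD('m). g i)" by (rule sum_pos)
  also have "\<dots> = (\<Sum>i<s. g i)"
    using s by (intro sum.mono_neutral_right) (auto simp: g_def)
  also have "\<dots> = LA / fact p * (if pos c < s then vec_index (B_app s y) (pos c) else 0)"
    by (simp add: g_def B_app_index_sum sum_distrib_left sum_divide_distrib mult.assoc)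
  finally show ?thesis .
qed

text \<open>The rows of \<open>B_mat s\<close> as vectors, continued by unit vectors: they play the
  role of \<open>l\<close> in \<open>power_field\<close>.\<close>

definition f_row :: "nat \<Rightarrow> nat \<Rightarrow> real ^ 'n::{finite,linorder}" where
  "f_row s r = (if s \<le> r then axis (idx r) 1
     else if r = 0 then axis (idx (s - 1)) 1
     else axis (idx (s - r - 1)) 1 - axis (idx (s - r)) 1)"

lemma inner_f_row:
  "inner (f_row s r) x = (if r < s then vec_index (B_app s x) r else x $ idx r)"
  by (auto simp: f_row_def B_app_index inner_axis' inner_diff_left)

lemma f_inst_rows:
  fixes x :: "real ^ 'n::{finite,linorder}"
  assumes "s \<le> CARD('n)"
  shows "f_inst p Lf LA s x =
    Lf / fact (p + 1) * (\<Sum>r<CARD('n). \<bar>inner (f_row s r) x\<bar> ^ (p + 1))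
    - inner (((Lf + LA / 2) / fact p) *\<^sub>R axis (idx 0) 1) x"
proof -
  have "(\<Sum>r<CARD('n). \<bar>inner (f_row s r) x\<bar> ^ (p + 1)) =
      (\<Sum>r<s. \<bar>inner (f_row s r) x\<bar> ^ (p + 1)) + (\<Sum>r = s..<CARD('n). \<bar>inner (f_row s r) x\<bar> ^ (p + 1))"
    using assms by (simp add: lessThan_atLeast0 sum.atLeastLessThan_concat)
  then show ?thesis by (simp add: f_inst_def inner_f_row inner_axis')
qed

section \<open>The gradient of the objective\<close>

lemma gradient_eqI: "GDERIV g x :> D \<Longrightarrow> gradient g x = D"
  unfolding gradient_def
proof (rule the_equality)
  fix D' assume "GDERIV g x :> D" "GDERIV g x :> D'"
  then have "(\<lambda>h. inner h D) = (\<lambda>h. inner h D')"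
    unfolding gderiv_def by (rule has_derivative_unique)
  then show "D' = D" by (metis inner_commute vector_eq_rdot)
qed

lemma gradient_f_inst:
  fixes x :: "real ^ 'n::{finite,linorder}"
  assumes "s \<le> CARD('n)" "1 \<le> p"
  shows "gradient (f_inst p Lf LA s) x =
    (\<Sum>r<CARD('n). (Lf / fact p * abs_power_deriv p 0 (inner (f_row s r) x)) *\<^sub>R f_row s r)
    - ((Lf + LA / 2) / fact p) *\<^sub>R axis (idx 0) 1"
proof (rule gradient_eqI)
  have *: "((\<lambda>x. \<bar>inner (f_row s r) x\<bar> ^ (p + 1)) has_derivative
      (\<lambda>h. real (p + 1) * abs_power_deriv p 0 (inner (f_row s r) x) * inner (f_row s r) h)) (at x)" for r
  proof -
    have "DERIV (\<lambda>u. \<bar>u\<bar> ^ (p + 1)) (inner (f_row s r) x)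
        :> real (p + 1) * abs_power_deriv p 0 (inner (f_row s r) x)"
      using DERIV_abs_power_sgn[of "p + 1" 0 "inner (f_row s r) x"] assms(2)
      by (simp add: abs_power_deriv_def mult.assoc)
    then have "((\<lambda>u. \<bar>u\<bar> ^ (p + 1)) has_derivative
        (\<lambda>h. real (p + 1) * abs_power_deriv p 0 (inner (f_row s r) x) * h)) (at (inner (f_row s r) x))"
      by (simp only: has_field_derivative_def)
    moreover have "(inner (f_row s r) has_derivative inner (f_row s r)) (at x)"
      by (auto intro!: derivative_eq_intros)
    ultimately show ?thesis by (rule has_derivative_compose[rotated])
  qed
  have C: "Lf / fact (p + 1) * real (p + 1) = Lf / fact p" by simp
  show "GDERIV (f_inst p Lf LA s) x :>
      (\<Sum>r<CARD('n). (Lf / fact p * abs_power_deriv p 0 (inner (f_row s r) x)) *\<^sub>R f_row s r)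
      - ((Lf + LA / 2) / fact p) *\<^sub>R axis (idx 0) 1"
    unfolding gderiv_def f_inst_rows[OF assms(1), abs_def]
    apply (rule has_derivative_eq_rhs)
     apply (rule has_derivative_diff[OF has_derivative_mult_right[OF has_derivative_sum[OF *]]])
     apply (auto intro!: derivative_eq_intros)[1]
    unfolding C[symmetric]
    by (simp only: inner_diff_right inner_sum_right inner_scaleR_right sum_distrib_left)
       (simp add: fun_eq_iff inner_commute mult_ac inner_axis' inner_axis)
qed

subsection \<open>Primal and dual values\<close>

text \<open>This bounds the problem for a single coordinate difference. The exact minimum involves a
  \<open>p\<close>-th root of \<open>1 + u\<close>; a polynomial bound lets \<open>gap_ge\<close>
  finish by algebra.\<close>

lemma abs_power_minus_linear_ge:
  fixes d u :: real
  assumes p: "1 \<le> p" and u: "0 \<le> u"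
  shows "\<bar>d\<bar> ^ (p + 1) - real (p + 1) * (1 + u) * d \<ge> - ((1 + u) * (real p + u))"
proof -
  \<comment> \<open>Tangent at the minimiser \<open>a\<close>, followed by \<open>a \<le> 1 + u / p\<close>.\<close>
  define a where "a = root p (1 + u)"
  have a: "a > 0" "a ^ p = 1 + u" using p u by (auto simp: a_def)
  have "1 + real p * (u / real p) \<le> (1 + u / real p) ^ p"
    using u by (intro Bernoulli_inequality) (simp add: order_trans[of _ 0])
  then have "a ^ p \<le> (1 + u / real p) ^ p" using p a by simp
  then have "a \<le> 1 + u / real p"
    using u by (intro power_le_imp_le_base[of a "p - 1"]) (use p in simp_all)
  then have pa: "real p * a \<le> real p + u" using p by (simp add: field_simps)
  have "1 + real (p + 1) * (\<bar>d\<bar> / a - 1) \<le> (1 + (\<bar>d\<bar> / a - 1)) ^ (p + 1)"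
    using a by (intro Bernoulli_inequality) simp
  then have "a ^ (p + 1) * (1 + real (p + 1) * (\<bar>d\<bar> / a - 1)) \<le> a ^ (p + 1) * (\<bar>d\<bar> / a) ^ (p + 1)"
    using a(1) by (intro mult_left_mono) auto
  also have "\<dots> = \<bar>d\<bar> ^ (p + 1)" using a(1) by (simp only: power_mult_distrib[symmetric]) simp
  also have "a ^ (p + 1) * (1 + real (p + 1) * (\<bar>d\<bar> / a - 1))
      = a ^ p * (a * (1 + real (p + 1) * (\<bar>d\<bar> / a - 1)))" by simp
  also have "a * (1 + real (p + 1) * (\<bar>d\<bar> / a - 1)) = real (p + 1) * \<bar>d\<bar> - real p * a"
    using a(1) by (simp add: field_simps)
  finally have "(1 + u) * (real (p + 1) * \<bar>d\<bar> - real p * a) \<le> \<bar>d\<bar> ^ (p + 1)" unfolding a(2) .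
  moreover have "(1 + u) * (real (p + 1) * d - (real p + u)) \<le> (1 + u) * (real (p + 1) * \<bar>d\<bar> - real p * a)"
    using u pa by (intro mult_left_mono diff_mono) auto
  ultimately show ?thesis by (simp add: algebra_simps)
qed

text \<open>As \<open>x $ idx t = 0\<close>, the first coordinate telescopes into \<open>t\<close>
  differences. Each is the value of a different row, and the other rows contribute nonnegative
  powers.\<close>

lemma sum_rows_ge:
  fixes x :: "real ^ 'n::{finite,linorder}"
  assumes t: "t < s" "s \<le> CARD('n)" and x: "x $ idx t = 0"
    and q: "1 \<le> p" and u: "0 \<le> u"
  shows "(\<Sum>r<CARD('n). \<bar>inner (f_row s r) x\<bar> ^ (p + 1)) - real (p + 1) * (1 + u) * x $ idx 0
    \<ge> - (real t * ((1 + u) * (real p + u)))"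
proof -
  define d where "d j = x $ idx j - x $ idx (Suc j)" for j
  have "(\<Sum>j<t. d j) = x $ idx 0 - x $ idx t"
    unfolding d_def by (rule sum_lessThan_telescope')
  then have tel: "x $ idx 0 = (\<Sum>j<t. d j)" using x by simp
  have inj: "inj_on (\<lambda>j. s - Suc j) {..<t}"
    using t by (auto simp: inj_on_def)
  \<comment> \<open>Row \<open>s - Suc j\<close> gives exactly \<open>d j\<close>; it is never the
    special row 0, because \<open>j < t < s\<close>.\<close>
  have "(\<Sum>j<t. \<bar>d j\<bar> ^ (p + 1)) = (\<Sum>j<t. \<bar>inner (f_row s (s - Suc j)) x\<bar> ^ (p + 1))"
    using t by (intro sum.cong) (auto simp: inner_f_row B_app_index d_def Suc_diff_Suc)
  also have "\<dots> = (\<Sum>r\<in>(\<lambda>j. s - Suc j) ` {..<t}. \<bar>inner (f_row s r) x\<bar> ^ (p + 1))"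
    by (simp add: sum.reindex[OF inj])
  also have "\<dots> \<le> (\<Sum>r<CARD('n). \<bar>inner (f_row s r) x\<bar> ^ (p + 1))"
    using t by (intro sum_mono2) auto
  finally have "(\<Sum>j<t. \<bar>d j\<bar> ^ (p + 1) - real (p + 1) * (1 + u) * d j)
      \<le> (\<Sum>r<CARD('n). \<bar>inner (f_row s r) x\<bar> ^ (p + 1)) - real (p + 1) * (1 + u) * x $ idx 0"
    by (simp only: tel sum_subtractf sum_distrib_left)
  moreover have "(\<Sum>j<t. - ((1 + u) * (real p + u)))
      \<le> (\<Sum>j<t. \<bar>d j\<bar> ^ (p + 1) - real (p + 1) * (1 + u) * d j)"
    by (intro sum_mono abs_power_minus_linear_ge q u)
  ultimately show ?thesis by simp
qed

lemma sum_squares_rev: "6 * (\<Sum>j<s. (real (s - j))\<^sup>2) = real s * (real s + 1) * (2 * real s + 1)"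
proof -
  have "(\<Sum>j<s. (real (s - j))\<^sup>2) = (\<Sum>j<s. (real (Suc (s - Suc j)))\<^sup>2)"
    by (intro sum.cong) (auto simp: Suc_diff_Suc)
  also have "\<dots> = (\<Sum>j<s. (real (Suc j))\<^sup>2)"
    by (rule sum.nat_diff_reindex)
  also have "6 * \<dots> = real s * (real s + 1) * (2 * real s + 1)"
    by (induction s) (auto simp: algebra_simps power2_eq_square)
  finally show ?thesis .
qed

lemma R_X_sq: "(R_X t)\<^sup>2 = 3 * (real t + 1) ^ 3" by (simp add: R_X_def)
lemma R_Y_sq: "(R_Y t)\<^sup>2 = real t + 1" by (simp add: R_Y_def)

lemma inner_vec_pos:
  fixes u v :: "real ^ 'i::{finite,linorder}"
  shows "inner u v = (\<Sum>i<CARD('i). u $ idx i * v $ idx i)"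
  using sum_pos[where 'i='i, of "\<lambda>i. u $ idx i * v $ idx i"] by (simp add: inner_vec_def idx_pos)

lemma phi_ge:
  fixes A :: "real ^ 'n ^ 'm" and y :: "real ^ 'm"
  assumes "y \<in> Y_set t"
  shows "phi f A b (Y_set t) x \<ge> f x + inner (A *v x - b) y"
proof -
  \<comment> \<open>A real \<open>SUP\<close> is known to dominate its terms only for sets bounded
    above; Cauchy-Schwarz on the ball supplies this.\<close>
  have "bdd_above ((\<lambda>y. inner (A *v x - b) y) ` (Y_set t :: (real ^ 'm) set))"
  proof (rule bdd_aboveI2)
    fix y :: "real ^ 'm" assume "y \<in> Y_set t"
    then have "norm y \<le> \<bar>R_Y t\<bar>" by (simp add: Y_set_def abs_le_square_iff[symmetric])
    then show "inner (A *v x - b) y \<le> norm (A *v x - b) * \<bar>R_Y t\<bar>"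
      by (meson norm_cauchy_schwarz order_trans mult_left_mono norm_ge_zero)
  qed
  then show ?thesis unfolding phi_def using cSUP_upper[OF assms] by fastforce
qed

lemma X_set_eq_cball: "X_set t = cball 0 (R_X t)"
proof -
  have "0 \<le> R_X t" by (simp add: R_X_def)
  then show ?thesis by (auto simp: X_set_def power_mono_iff abs_le_square_iff[symmetric])
qed

text \<open>A continuous function on a compact ball is bounded below, so the \<open>INF\<close> is a
  true lower bound of its terms.\<close>

lemma psi_le:
  assumes x: "x \<in> X_set t" and f: "continuous_on UNIV f"
  shows "psi f A b (X_set t) y \<le> zeta f A b x y"
  unfolding psi_def
proof (rule cINF_lower[OF _ x])
  have "continuous_on (X_set t) (\<lambda>x. zeta f A b x y)"
    unfolding zeta_def
    by (intro continuous_intros continuous_on_subset[OF f]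
        linear_continuous_on[OF matrix_vector_mul_bounded_linear]) auto
  then have "compact ((\<lambda>x. zeta f A b x y) ` X_set t)"
    by (intro compact_continuous_image) (auto simp: X_set_eq_cball)
  then show "bdd_below ((\<lambda>x. zeta f A b x y) ` X_set t)"
    by (intro bounded_imp_bdd_below compact_imp_bounded)
qed

lemma continuous_f_inst:
  assumes "s \<le> CARD('n)"
  shows "continuous_on UNIV (f_inst p Lf LA s :: real ^ 'n::{finite,linorder} \<Rightarrow> real)"
  unfolding f_inst_rows[OF assms, abs_def] by (intro continuous_intros)

subsection \<open>Reachable coordinates\<close>

text \<open>The second component ranges over the span of \<open>1\<^sub>s\<close> and the last \<open>k\<close> of the first \<open>s\<close> unit vectors.\<close>

definition reach :: "nat \<Rightarrow> nat \<Rightarrow> ((real ^ 'n::{finite,linorder}) \<times> (real ^ 'm::{finite,linorder})) set" where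
  "reach s k = {(x, y). (\<forall>j. k \<le> j \<longrightarrow> j < CARD('n) \<longrightarrow> x $ idx j = 0)
     \<and> (\<forall>i. s \<le> i \<longrightarrow> i < CARD('m) \<longrightarrow> y $ idx i = 0)
     \<and> (\<forall>i i'. i < s - k \<longrightarrow> i' < s - k \<longrightarrow> y $ idx i = y $ idx i')}"

lemma reach_iff:
  fixes x :: "real ^ 'n::{finite,linorder}" and y :: "real ^ 'm::{finite,linorder}"
  shows "(x, y) \<in> reach s k \<longleftrightarrow> (\<forall>j. k \<le> j \<longrightarrow> j < CARD('n) \<longrightarrow> x $ idx j = 0)
     \<and> (\<forall>i. s \<le> i \<longrightarrow> i < CARD('m) \<longrightarrow> y $ idx i = 0)
     \<and> (\<forall>i i'. i < s - k \<longrightarrow> i' < s - k \<longrightarrow> y $ idx i = y $ idx i')"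
  unfolding reach_def mem_Collect_eq prod.case by (rule refl)

lemma subspace_reach:
  "Real_Vector_Spaces.subspace
    (reach s k :: ((real ^ 'n::{finite,linorder}) \<times> (real ^ 'm::{finite,linorder})) set)"
proof (rule Real_Vector_Spaces.subspaceI)
  show "0 \<in> reach s k" by (simp add: reach_def zero_prod_def)
next
  fix u v :: "(real ^ 'n::{finite,linorder}) \<times> (real ^ 'm::{finite,linorder})"
  assume "u \<in> reach s k" "v \<in> reach s k"
  then show "u + v \<in> reach s k"
    unfolding reach_def split_def mem_Collect_eq fst_add snd_add vector_add_component
    by (elim conjE, intro conjI allI impI) (metis add_0, metis add_0, metis)
next
  fix c and u :: "(real ^ 'n::{finite,linorder}) \<times> (real ^ 'm::{finite,linorder})"
  assume "u \<in> reach s k"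
  then show "c *\<^sub>R u \<in> reach s k"
    unfolding reach_def split_def mem_Collect_eq fst_scaleR snd_scaleR vector_scaleR_component
    by (elim conjE, intro conjI allI impI) (metis scaleR_zero_right, metis scaleR_zero_right, metis)
qed

lemma reach_mono: "k \<le> k' \<Longrightarrow> reach s k \<subseteq> reach s k'"
  by (auto simp: reach_def)

lemma idx_eq_iff:
  "i < CARD('i::{finite,linorder}) \<Longrightarrow> j < CARD('i) \<Longrightarrow> (idx i :: 'i) = idx j \<longleftrightarrow> i = j"
  by (metis pos_idx)

text \<open>Each condition defining \<open>reach s (k + 1)\<close> is orthogonality to test vectors
  \<open>(axis (idx j) 1, 0)\<close>, \<open>(0, axis (idx i) 1)\<close> or a difference of two of
  the latter, so \<open>S_space_orthogonal\<close> applies to each.\<close>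

lemma S_space_reach:
  fixes z :: "(real ^ 'n::{finite,linorder}) \<times> (real ^ 'm::{finite,linorder})"
  assumes p: "1 \<le> p" and s: "s \<le> CARD('m)" "CARD('m) \<le> CARD('n)" and k: "k < s"
    and G: "G \<in> carrier_mat (CARD('m) - s) (CARD('m) - s)"
    and z: "z \<in> reach s k"
  shows "S_space p (F_op (f_inst p Lf LA s) (A_inst p LA s G) (b_inst p LA s)) z \<subseteq> reach s (k + 1)"
proof
  let ?A = "A_inst p LA s G :: real ^ 'n::{finite,linorder} ^ 'm::{finite,linorder}"
  let ?b = "b_inst p LA s :: real ^ 'm::{finite,linorder}"
  let ?F = "F_op (f_inst p Lf LA s) ?A ?b"
  let ?c = "((Lf + LA / 2) / fact p) *\<^sub>R axis (idx 0) 1 :: real ^ 'n::{finite,linorder}"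
  interpret power_field "{..<CARD('n)}" "\<lambda>r. (f_row s r :: real ^ 'n::{finite,linorder}, 0 :: real ^ 'm::{finite,linorder})" "Lf / fact p" p
    "(- ?c, ?b)" "\<lambda>(x, y). (transpose ?A *v y, - (?A *v x))" ?F
  proof (rule power_field.intro)
    show "linear (\<lambda>(x, y). (transpose ?A *v y, - (?A *v x)))"
      by (rule linearI) (auto simp: matrix_vector_right_distrib matrix_vector_mult_scaleR
          simp del: transpose_matrix_vector)
    show "inner ((\<lambda>(x, y). (transpose ?A *v y, - (?A *v x))) h) h = 0" for h
      by (cases h) (simp add: dot_lmul_matrix[symmetric] inner_commute)
    show "?F z = (\<Sum>r<CARD('n). (Lf / fact p * abs_power_deriv p 0 (inner (f_row s r, 0) z)) *\<^sub>R (f_row s r, 0))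
        + (- ?c, ?b) + (\<lambda>(x, y). (transpose ?A *v y, - (?A *v x))) z" for z
    proof (cases z)
      case (Pair a b)
      show ?thesis
        unfolding Pair F_op_def using s p
        by (auto simp: gradient_f_inst prod_eq_iff fst_sum snd_sum scaleR_prod_def)
    qed
  qed
  obtain x y where zxy: "z = (x, y)" by (cases z)
  have x0: "x $ idx j = 0" if "k \<le> j" "j < CARD('n)" for j
    using z[unfolded zxy reach_iff] that by blast
  have y0: "y $ idx i = 0" if "s \<le> i" "i < CARD('m)" for i
    using z[unfolded zxy reach_iff] that by blast
  have yeq: "y $ idx i = y $ idx i'" if "i < s - k" "i' < s - k" for i i'
    using z[unfolded zxy reach_iff] that by blast
  have Ax: "(?A *v x) $ idx i = LA / fact p * (if i < s then vec_index (B_app s x) i else 0)"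
    if "i < CARD('m)" for i
    using x0 k that by (subst A_inst_mult[OF s G]) (auto simp: pos_idx)
  have Ay: "(transpose ?A *v y) $ idx j = LA / fact p * (if j < s then vec_index (B_app s y) j else 0)"
    if "j < CARD('n)" for j
    using that by (subst A_inst_transpose_mult[OF s(1) G y0]) (auto simp: pos_idx)
  fix w assume w: "w \<in> S_space p ?F z"
  obtain wx wy where wxy: "w = (wx, wy)" by (cases w)
  have "wx $ idx j = 0" if j: "k + 1 \<le> j" "j < CARD('n)" for j
  proof -
    \<comment> \<open>A row that is nonzero on \<open>x\<close> is supported on positions up to
      \<open>k\<close>, so it does not see position \<open>j\<close>.\<close>
    have rows: "inner (f_row s r) x = 0 \<or> inner (f_row s r) (axis (idx j) 1 :: real ^ 'n::{finite,linorder}) = 0"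
      if r: "r < CARD('n)" for r
      using r j k s x0[of r] x0[of "s - 1"] x0[of "s - r"] x0[of "s - r - 1"]
      by (auto simp: inner_f_row B_app_index axis_def idx_eq_iff)
    \<comment> \<open>For \<open>j < s\<close> this is a multiple of the difference of
      \<open>y\<close> at \<open>s - j - 1\<close> and \<open>s - j\<close>, both below
      \<open>s - k\<close>, where \<open>y\<close> is constant.\<close>
    have "(transpose ?A *v y) $ idx j = 0"
      using j y0[of j] yeq[of "s - j - 1" "s - j"] k by (subst Ay) (auto simp: B_app_index)
    moreover have "(axis (idx 0) 1 :: real ^ 'n::{finite,linorder}) $ idx j = 0"
      using j by (auto simp: axis_def idx_eq_iff)
    moreover have "(\<Sum>r<CARD('n). (Lf / fact p * abs_power_deriv p 0 (inner (f_row s r) x))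
        * inner (f_row s r) (axis (idx j) 1 :: real ^ 'n::{finite,linorder})) = 0"
      using rows p by (intro sum.neutral) fastforce
    ultimately have "inner (?F z) (axis (idx j) 1, 0) = 0"
      unfolding zxy F_op_def using s p
      by (simp add: gradient_f_inst inner_add_left inner_diff_left inner_sum_left inner_axis)
    then have "inner w (axis (idx j) 1, 0) = 0"
      by (rule S_space_orthogonal[OF w]) (use rows zxy in auto)
    then show ?thesis by (simp add: wxy inner_axis)
  qed
  moreover have "wy $ idx i = 0" if i: "s \<le> i" "i < CARD('m)" for i
  proof -
    have "inner (?F z) (0, axis (idx i) 1) = 0"
      using i Ax[of i] by (simp add: zxy F_op_def inner_axis inner_diff_left b_inst_def pos_idx)
    then have "inner w (0, axis (idx i) 1) = 0" by (rule S_space_orthogonal[OF w]) auto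
    then show ?thesis by (simp add: wxy inner_axis)
  qed
  moreover have "wy $ idx i = wy $ idx i'" if i: "i < s - (k + 1)" "i' < s - (k + 1)" for i i'
  proof -
    \<comment> \<open>Here only coordinates of \<open>x\<close> from position \<open>k\<close> on
      enter. The entries of \<open>b\<close> at \<open>i\<close> and \<open>i'\<close> are equal and
      cancel in the test vector.\<close>
    have "(?A *v x) $ idx a = 0" if "a < s - (k + 1)" for a
      using that s x0[of "s - 1"] x0[of "s - a - 1"] x0[of "s - a"] Ax[of a]
      by (auto simp: B_app_index)
    moreover have "i < s" "i' < s" using i by auto
    ultimately have "inner (?F z) (0, axis (idx i) 1 - axis (idx i') 1) = 0"
      using i s
      by (simp add: zxy F_op_def inner_axis inner_diff_left inner_diff_right b_inst_def pos_idx)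
    then have "inner w (0, axis (idx i) 1 - axis (idx i') 1) = 0"
      by (rule S_space_orthogonal[OF w]) auto
    then show ?thesis by (simp add: wxy inner_axis inner_diff_right)
  qed
  ultimately show "w \<in> reach s (k + 1)" unfolding wxy reach_iff by blast
qed

text \<open>The iterate \<open>z k\<close> sums directions found at all earlier iterates, hence the
  strong induction; those found at \<open>z i\<close> lie in \<open>reach s (i + 1)\<close>, which
  is contained in \<open>reach s k\<close>.\<close>

lemma oracle_reach:
  fixes z :: "nat \<Rightarrow> (real ^ 'n::{finite,linorder}) \<times> (real ^ 'm::{finite,linorder})"
  assumes p: "1 \<le> p" and s: "s \<le> CARD('m)" "CARD('m) \<le> CARD('n)"
    and G: "G \<in> carrier_mat (CARD('m) - s) (CARD('m) - s)"
    and "oracle_assumption p (F_op (f_inst p Lf LA s) (A_inst p LA s G) (b_inst p LA s)) Z z"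
    and "z 0 = 0" and "k \<le> s"
  shows "z k \<in> reach s k"
  using assms(7)
proof (induction k rule: less_induct)
  case (less k)
  show ?case
  proof (cases k)
    case 0
    then show ?thesis using subspace_0[OF subspace_reach] assms(6) by simp
  next
    case (Suc j)
    then obtain w where w: "z k = z 0 + (\<Sum>i\<le>j. w i)"
      "\<And>i. i \<le> j \<Longrightarrow> w i \<in> S_space p (F_op (f_inst p Lf LA s) (A_inst p LA s G) (b_inst p LA s)) (z i)"
      using assms(5) unfolding oracle_assumption_def by blast
    have "w i \<in> reach s k" if i: "i \<le> j" for i
      using S_space_reach[OF p s _ G less.IH[of i]] w(2)[OF i] i less.prems Suc
        reach_mono[of "i + 1" k s] by fastforce
    then show ?thesis
      using w(1) assms(6) subspace_sum[OF subspace_reach] by (metis add_0 atMost_iff)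
  qed
qed

subsection \<open>The gap\<close>

definition x_opt :: "nat \<Rightarrow> real ^ 'n::{finite,linorder}" where
  "x_opt s = (\<chi> c. if pos c < s then real (s - pos c) else 0)"

lemma x_opt_idx:
  "j < CARD('n) \<Longrightarrow> (x_opt s :: real ^ 'n::{finite,linorder}) $ idx j = (if j < s then real (s - j) else 0)"
  by (simp add: x_opt_def pos_idx)

text \<open>The last of the first \<open>s\<close> entries of \<open>x_opt s\<close> is 1, and
  consecutive ones differ by 1.\<close>

lemma B_app_x_opt:
  assumes "i < s" "s \<le> CARD('n)"
  shows "vec_index (B_app s (x_opt s :: real ^ 'n::{finite,linorder})) i = 1"
  using assms by (auto simp: B_app_index x_opt_idx)

lemma A_inst_x_opt:
  assumes "s \<le> CARD('m::{finite,linorder})" "CARD('m) \<le> CARD('n::{finite,linorder})"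
    and "G \<in> carrier_mat (CARD('m) - s) (CARD('m) - s)"
  shows "(A_inst p LA s G :: real ^ 'n::{finite,linorder} ^ 'm::{finite,linorder}) *v x_opt s = b_inst p LA s"
  using assms by (auto simp: Finite_Cartesian_Product.vec_eq_iff A_inst_mult x_opt_idx B_app_x_opt b_inst_def)

lemma f_inst_x_opt:
  assumes "0 < s" "s \<le> CARD('n)"
  shows "f_inst p Lf LA s (x_opt s :: real ^ 'n::{finite,linorder}) =
    Lf / fact (p + 1) * real s - 1 / fact p * (Lf + LA / 2) * real s"
  using assms by (simp add: f_inst_def B_app_x_opt x_opt_idx)

lemma x_opt_mem_X_set:
  assumes "2 * t + 1 \<le> CARD('n)"
  shows "(x_opt (2 * t + 1) :: real ^ 'n::{finite,linorder}) \<in> X_set t"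
proof -
  let ?s = "2 * t + 1"
  have "(norm (x_opt ?s :: real ^ 'n::{finite,linorder}))\<^sup>2
      = (\<Sum>j<CARD('n). (if j < ?s then real (?s - j) else 0)\<^sup>2)"
    unfolding power2_norm_eq_inner inner_vec_pos
    by (intro sum.cong) (auto simp: x_opt_idx power2_eq_square)
  also have "\<dots> = (\<Sum>j<?s. (if j < ?s then real (?s - j) else 0)\<^sup>2)"
    using assms by (intro sum.mono_neutral_right) auto
  also have "\<dots> = (\<Sum>j<?s. (real (?s - j))\<^sup>2)" by (intro sum.cong) auto
  also have "\<dots> \<le> 3 * (real t + 1) ^ 3"
  proof -
    \<comment> \<open>Both sides times 6, with \<open>s = 2 * t + 1\<close> in the sum of squares;
      the remainder has nonnegative coefficients.\<close>
    have "18 * (real t + 1) ^ 3 = (2 * real t + 1) * (2 * real t + 2) * (4 * real t + 3)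
        + (2 * real t ^ 3 + 18 * (real t)\<^sup>2 + 28 * real t + 12)"
      by (simp add: algebra_simps power2_eq_square power3_eq_cube)
    moreover have "0 \<le> 2 * real t ^ 3 + 18 * (real t)\<^sup>2 + 28 * real t + 12" by simp
    moreover have "6 * (\<Sum>j<?s. (real (?s - j))\<^sup>2) = (2 * real t + 1) * (2 * real t + 2) * (4 * real t + 3)"
      unfolding sum_squares_rev by (simp add: ac_simps)
    ultimately show ?thesis by linarith
  qed
  finally show ?thesis by (simp add: X_set_def R_X_sq)
qed

text \<open>The gap estimate before the radii are inserted: a test vector bounds the primal value
  below, and \<open>x_opt s\<close> bounds the dual value above.\<close>

lemma gap_ge:
  fixes xbar :: "real ^ 'n::{finite,linorder}" and ybar :: "real ^ 'm::{finite,linorder}"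
  assumes p: "1 \<le> p" and st: "s = 2 * t + 1" "s \<le> CARD('m)" "CARD('m) \<le> CARD('n)"
    and L: "0 < Lf" "0 \<le> LA" "LA \<le> Lf"
    and G: "G \<in> carrier_mat (CARD('m) - s) (CARD('m) - s)"
    and x: "\<And>j. t \<le> j \<Longrightarrow> j < CARD('n) \<Longrightarrow> xbar $ idx j = 0"
  defines "f \<equiv> f_inst p Lf LA s" and "A \<equiv> A_inst p LA s G" and "b \<equiv> b_inst p LA s"
  shows "phi f A b (Y_set t) xbar - psi f A b (X_set t) ybar
    \<ge> real p * Lf / fact (p + 1) * ((real t + 1) / 10) + LA / fact p * (real t + 1)"
proof -
  \<comment> \<open>\<open>u\<close> is the relative increase of the linear coefficient caused by
    \<open>LA\<close>; \<open>LA \<le> Lf\<close> gives \<open>u \<le> 1 / 2\<close>.\<close>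
  define D u where "D = Lf / fact (p + 1)" and "u = LA / (2 * Lf)"
  have D: "D > 0" and u: "0 \<le> u" "u \<le> 1 / 2" using L by (auto simp: D_def u_def)
  have Lu: "Lf + LA / 2 = Lf * (1 + u)" using L by (simp add: u_def field_simps)
  have "D * real (p + 1) = Lf / fact p" by (simp add: D_def)
  then have c: "(Lf + LA / 2) / fact p = D * (real (p + 1) * (1 + u))"
    unfolding Lu by (metis mult.assoc times_divide_eq_left)
  \<comment> \<open>The first \<open>s - t = t + 1\<close> entries of \<open>A *v xbar\<close> read
    only coordinates from \<open>t\<close> on, so they vanish. Entries \<open>- 1\<close> there
    match the sign of \<open>- b\<close> and use up the squared radius \<open>t + 1\<close>.\<close>
  define y :: "real ^ 'm::{finite,linorder}" where "y = (\<chi> r. if pos r < t + 1 then - 1 else 0)"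
  have y_idx: "y $ idx i = (if i < t + 1 then - 1 else 0)" if "i < CARD('m)" for i
    using that by (simp add: y_def pos_idx)
  have "(norm y)\<^sup>2 = (\<Sum>i<CARD('m). if i < t + 1 then 1 else 0)"
    unfolding power2_norm_eq_inner inner_vec_pos by (intro sum.cong) (auto simp: y_idx)
  also have "\<dots> = (\<Sum>i<t + 1. if i < t + 1 then 1 else 0)"
    using st by (intro sum.mono_neutral_right) auto
  finally have "y \<in> Y_set t" by (simp add: Y_set_def R_Y_sq)
  note phi_ge[OF this, of f xbar A b]
  moreover have "inner (A *v xbar - b) y = LA / fact p * (real t + 1)"
  proof -
    have "(A *v xbar - b) $ idx i * y $ idx i = (if i < t + 1 then LA / fact p else 0)"
      if i: "i < CARD('m)" for i
      unfolding A_def vector_minus_component using i st x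
      by (subst A_inst_mult[OF st(2,3) G])
        (auto simp: b_def b_inst_def y_idx B_app_index pos_idx)
    then have "inner (A *v xbar - b) y = (\<Sum>i<CARD('m). if i < t + 1 then LA / fact p else 0)"
      unfolding inner_vec_pos by (intro sum.cong) auto
    also have "\<dots> = (\<Sum>i<t + 1. if i < t + 1 then LA / fact p else 0)"
      using st by (intro sum.mono_neutral_right) auto
    finally show ?thesis by simp
  qed
  moreover have "f xbar \<ge> D * - (real t * ((1 + u) * (real p + u)))"
  proof -
    have "f xbar = D * ((\<Sum>r<CARD('n). \<bar>inner (f_row s r) xbar\<bar> ^ (p + 1))
        - real (p + 1) * (1 + u) * xbar $ idx 0)"
      unfolding f_def using st
      by (subst f_inst_rows) (simp_all only: c D_def[symmetric], simp_all add: inner_axis' algebra_simps)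
    also have "\<dots> \<ge> D * - (real t * ((1 + u) * (real p + u)))"
      using D st p u x by (intro mult_left_mono sum_rows_ge) auto
    finally show ?thesis .
  qed
  moreover have "psi f A b (X_set t) ybar \<le> - (D * (real s * (real p + real (p + 1) * u)))"
  proof -
    have "psi f A b (X_set t) ybar \<le> zeta f A b (x_opt s) ybar"
      using x_opt_mem_X_set[of t, where 'n='n] st
      by (intro psi_le) (auto simp: f_def intro!: continuous_f_inst)
    also have "\<dots> = f (x_opt s)"
      unfolding zeta_def A_def b_def A_inst_x_opt[OF st(2,3) G] by simp
    also have "\<dots> = D * real s - D * (real (p + 1) * (1 + u)) * real s"
      unfolding f_def using st by (subst f_inst_x_opt) (simp_all add: c[symmetric] D_def Lu)
    finally show ?thesis by (simp add: algebra_simps)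
  qed
  moreover have "D * (real p * ((real t + 1) / 10))
      \<le> D * (real s * (real p + real (p + 1) * u) - real t * ((1 + u) * (real p + u)))"
  proof (rule mult_left_mono)
    \<comment> \<open>At \<open>u = 0\<close> the left side is \<open>p * (t + 1)\<close>; one tenth
      is kept and the rest joins the nonnegative remainder, where \<open>u \<le> 1\<close> is used
      for \<open>1 - u\<close>.\<close>
    have "real s * (real p + real (p + 1) * u) - real t * ((1 + u) * (real p + u))
        = real p * ((real t + 1) / 10) + (9 / 10 * (real p * (real t + 1)) + u
          + u * real p * (real t + 1) + real t * u * (1 - u))"
      unfolding st(1) by (simp add: field_simps)
    moreover have "0 \<le> 9 / 10 * (real p * (real t + 1)) + u
          + u * real p * (real t + 1) + real t * u * (1 - u)"
      using u by (intro add_nonneg_nonneg mult_nonneg_nonneg) auto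
    ultimately show "real p * ((real t + 1) / 10)
        \<le> real s * (real p + real (p + 1) * u) - real t * ((1 + u) * (real p + u))"
      by linarith
  qed (use D in simp)
  moreover have "real p * Lf / fact (p + 1) * ((real t + 1) / 10) = D * (real p * ((real t + 1) / 10))"
    by (simp add: D_def)
  ultimately show ?thesis by (simp only: right_diff_distrib mult_minus_right)
qed

section \<open>Powers of the radii\<close>

lemma R_X_eq: "R_X t = sqrt 3 * (real t + 1) powr (3 / 2)"
proof -
  have "(real t + 1) ^ 3 = (real t + 1) powr real 3" by (subst powr_realpow) auto
  then have "sqrt ((real t + 1) ^ 3) = ((real t + 1) powr real 3) powr (1 / 2)"
    by (simp only: powr_half_sqrt powr_ge_zero)
  also have "\<dots> = (real t + 1) powr (3 / 2)" by (simp only: powr_powr) simp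
  finally show ?thesis by (simp add: R_X_def real_sqrt_mult)
qed

lemma R_X_ratio:
  "R_X t ^ (p + 1) / (real t + 1) powr ((3 * real p + 1) / 2) = 3 powr ((real p + 1) / 2) * (real t + 1)"
proof -
  define T where "T = real t + 1"
  have T: "T > 0" by (simp add: T_def)
  have X: "R_X t = sqrt 3 * T powr (3 / 2)"
    unfolding T_def by (rule R_X_eq)
  have "R_X t = 3 powr (1 / 2) * T powr (3 / 2)"
    unfolding X using T by (simp add: powr_half_sqrt)
  then have "R_X t ^ (p + 1) = (3 powr (1 / 2) * T powr (3 / 2)) powr (real (p + 1))"
    using T by (subst powr_realpow) auto
  also have "\<dots> = 3 powr ((real p + 1) / 2) * T powr (3 * (real p + 1) / 2)"
    using T by (simp add: powr_mult powr_powr add.commute)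
  \<comment> \<open>Splitting off the exponent of the denominator leaves a single factor
    \<open>T\<close>, as in \<open>gap_ge\<close>.\<close>
  also have "3 * (real p + 1) / 2 = (3 * real p + 1) / 2 + 1" by (simp add: field_simps)
  finally show ?thesis using T unfolding T_def[symmetric] by (simp add: powr_add)
qed

lemma R_X_R_Y_ratio:
  "R_X t * R_Y t ^ p / (sqrt 3 * (real t + 1) powr ((real p + 1) / 2)) = real t + 1"
proof -
  define T where "T = real t + 1"
  have T: "T > 0" by (simp add: T_def)
  have X: "R_X t = sqrt 3 * T powr (3 / 2)"
    unfolding T_def by (rule R_X_eq)
  have "R_Y t ^ p = (T powr (1 / 2)) powr real p"
    using T unfolding R_Y_def T_def[symmetric] by (simp add: powr_realpow powr_half_sqrt)
  also have "\<dots> = T powr (real p / 2)" by (simp add: powr_powr)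
  finally have "R_X t * R_Y t ^ p = sqrt 3 * (T powr (3 / 2 + real p / 2))"
    unfolding X powr_add by simp
  also have "3 / 2 + real p / 2 = (real p + 1) / 2 + 1" by (simp add: field_simps)
  finally show ?thesis using T unfolding T_def[symmetric] by (simp add: powr_add)
qed

theorem theorem4p2:
  fixes p t s :: nat and Lf LA :: real and G :: "real mat"
    and f :: "real ^ 'n::{finite,linorder} \<Rightarrow> real"
    and A :: "real ^ 'n::{finite,linorder} ^ 'm::{finite,linorder}" and b :: "real ^ 'm::{finite,linorder}"
    and z :: "nat \<Rightarrow> (real ^ 'n::{finite,linorder}) \<times> (real ^ 'm::{finite,linorder})"
    and xbar :: "real ^ 'n::{finite,linorder}" and ybar :: "real ^ 'm::{finite,linorder}"
  assumes "2 \<le> p" and "1 \<le> t" and "s = 2 * t + 1"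
    and "s \<le> CARD('m)" and "CARD('m) \<le> CARD('n)"
    and "0 < Lf" and "0 \<le> LA" and "LA \<le> Lf"
    and "admissible_block (CARD('m) - s) G"
    and "f = f_inst p Lf LA s" and "A = A_inst p LA s G" and "b = b_inst p LA s"
    and "oracle_assumption p (F_op f A b) (X_set t \<times> Y_set t) z"
    and "z 0 = 0"
    and "z t = (xbar, ybar)"
  shows "phi f A b (Y_set t) xbar - psi f A b (X_set t) ybar
    \<ge> 1 / (10 * 3 powr (3 * (real p + 1) / 2)) * (real p * Lf / fact (p + 1))
        * (R_X t ^ (p + 1) / (real t + 1) powr ((3 * real p + 1) / 2))
      + LA / fact p * (R_X t * R_Y t ^ p / (sqrt 3 * (real t + 1) powr ((real p + 1) / 2)))"
proof -
  have G: "G \<in> carrier_mat (CARD('m) - s) (CARD('m) - s)"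
    using assms(9) by (simp add: admissible_block_def)
  have "z t \<in> reach s t"
    using assms G by (intro oracle_reach) auto
  then have x: "xbar $ idx j = 0" if "t \<le> j" "j < CARD('n)" for j
    unfolding assms(15) reach_iff using that by blast
  have "phi f A b (Y_set t) xbar - psi f A b (X_set t) ybar
      \<ge> real p * Lf / fact (p + 1) * ((real t + 1) / 10) + LA / fact p * (real t + 1)"
    unfolding assms(10-12) using assms(1) by (intro gap_ge assms(3-8) G x) auto
  moreover have "1 / (10 * 3 powr (3 * (real p + 1) / 2)) * (real p * Lf / fact (p + 1))
        * (R_X t ^ (p + 1) / (real t + 1) powr ((3 * real p + 1) / 2))
      \<le> real p * Lf / fact (p + 1) * ((real t + 1) / 10)"
  proof -
    define a where "a = real p * Lf / fact (p + 1) * ((real t + 1) / 10)"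
    \<comment> \<open>The power of 3 coming from \<open>R_X t ^ (p + 1)\<close> is at most the one
      in the denominator of the stated constant, so the bound of \<open>gap_ge\<close> is at least
      as strong.\<close>
    have "(3::real) powr ((real p + 1) / 2) \<le> 3 powr (3 * (real p + 1) / 2)"
      by (intro powr_mono) auto
    then have "a * (3 powr ((real p + 1) / 2) / 3 powr (3 * (real p + 1) / 2)) \<le> a * 1"
      using assms(6) by (intro mult_left_mono) (auto simp: a_def)
    moreover have "1 / (10 * v) * K * (w * T) = K * (T / 10) * (w / v)" for v w K T :: real
      by simp
    ultimately show ?thesis unfolding R_X_ratio by (simp only: a_def mult_1_right)
  qed
  ultimately show ?thesis unfolding R_X_R_Y_ratio by linarith
qed

end
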